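(* Let $0<\epsilon\le1$. There exists a randomized online algorithm for the $1$-Canadian Traveller Problem with predictions (i.e. $k=1$) on path-disjoint graphs that is $\left[1+\epsilon,\,1+\frac{1}{\epsilon}\right]$-competitive: on every instance whose prediction is correct, $\mathbb{E}[ALG]\le(1+\epsilon)OPT$, and on every instance whose prediction is not correct, $\mathbb{E}[ALG]\le\left(1+\frac{1}{\epsilon}\right)OPT$.
   Context: $k$-Canadian Traveller Problem ($k$-CTP) with predictions: an instance consists of a connected undirected graph $G=(V,E)$, a source $s$, a destination $t$, a nonnegative cost function $c:E\to\mathbb{R}^+$, an unknown set $B\subseteq E$ of blocked edges with $|B|\le k$ such that $G-B$ contains an $s$-$t$ path, and a predicted set $B_p\subseteq E$ of blocked edges with $|B_p|\le k$. The traveller knows $G,c,s,t,k,B_p$ in advance, starts at $s$, and learns whether an edge is blocked only upon reaching one of its endpoints; blocked edges cannot be traversed. $ALG$ is the (random) total cost travelled, with instances fixed in advance (oblivious adversary); $OPT$ is the cost of a shortest $s$-$t$ path in $G-B$. The prediction is correct iff $B=B_p$. A graph is path-disjoint if all its $s$-$t$ paths are pairwise node-disjoint apart from $s$ and $t$. *)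

theory Defs
  imports "HOL-Probability.Probability_Mass_Function"
begin

text \<open>
  Everything the traveller knows in advance. Undirected edges are two-element vertex sets; only the
  values of the cost function on the edge set are relevant.
\<close>

record 'v ctp_input =
  nodes :: "'v set"
  edges :: "'v set set"
  edge_cost :: "'v set \<Rightarrow> real"
  source :: 'v
  destination :: 'v
  budget :: nat
  prediction :: "'v set set"

definition is_path :: "'v set set \<Rightarrow> 'v \<Rightarrow> 'v \<Rightarrow> 'v list \<Rightarrow> bool" where
  "is_path F u v p \<longleftrightarrow>
     p \<noteq> [] \<and> hd p = u \<and> last p = v \<and> distinct p \<and> successively (\<lambda>x y. {x, y} \<in> F) p"

definition walk_cost :: "('v set \<Rightarrow> real) \<Rightarrow> 'v list \<Rightarrow> real" where
  "walk_cost c p = (\<Sum>(x, y) \<leftarrow> zip p (tl p). c {x, y})"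

definition valid_input :: "'v ctp_input \<Rightarrow> bool" where
  "valid_input I \<longleftrightarrow>
     finite (nodes I) \<and>
     edges I \<subseteq> {{u, v} | u v. u \<in> nodes I \<and> v \<in> nodes I \<and> u \<noteq> v} \<and>
     (\<forall>u\<in>nodes I. \<forall>v\<in>nodes I. \<exists>p. is_path (edges I) u v p) \<and>
     source I \<in> nodes I \<and> destination I \<in> nodes I \<and>
     (\<forall>e\<in>edges I. 0 \<le> edge_cost I e) \<and>
     prediction I \<subseteq> edges I \<and> card (prediction I) \<le> budget I"

definition valid_instance :: "'v ctp_input \<Rightarrow> 'v set set \<Rightarrow> bool" where
  "valid_instance I B \<longleftrightarrow>
     valid_input I \<and> B \<subseteq> edges I \<and> card B \<le> budget I \<and>
     (\<exists>p. is_path (edges I - B) (source I) (destination I) p)"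

definition path_disjoint :: "'v ctp_input \<Rightarrow> bool" where
  "path_disjoint I \<longleftrightarrow>
     (\<forall>p q. is_path (edges I) (source I) (destination I) p \<and>
            is_path (edges I) (source I) (destination I) q \<and> p \<noteq> q \<longrightarrow>
            set p \<inter> set q \<subseteq> {source I, destination I})"

definition OPT :: "'v ctp_input \<Rightarrow> 'v set set \<Rightarrow> real" where
  "OPT I B =
     Min (walk_cost (edge_cost I) ` {p. is_path (edges I - B) (source I) (destination I) p})"

text \<open>
  A deterministic online strategy chooses the next vertex from the walk made so far and the set of
  edges found to be blocked so far. This pair carries the full history: every other edge incident to
  a visited vertex is known to be free, and the time at which an edge was observed is determined by
  the walk.
\<close>

type_synonym 'v strategy = "'v list \<Rightarrow> 'v set set \<Rightarrow> 'v"

definition observed :: "'v set set \<Rightarrow> 'v list \<Rightarrow> 'v set set" where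
  "observed B w = {e \<in> B. e \<inter> set w \<noteq> {}}"

text \<open>
  The walk stops at the destination. An attempt to move along a blocked edge or a non-edge has no
  effect; the strategy then sees the same history again, so it never reaches the destination.
\<close>

primrec walk :: "'v ctp_input \<Rightarrow> 'v set set \<Rightarrow> 'v strategy \<Rightarrow> nat \<Rightarrow> 'v list" where
  "walk I B \<sigma> 0 = [source I]"
| "walk I B \<sigma> (Suc n) =
     (let w = walk I B \<sigma> n; v = \<sigma> w (observed B w)
      in if last w \<noteq> destination I \<and> {last w, v} \<in> edges I - B then w @ [v] else w)"

text \<open>A strategy that never reaches the destination has infinite cost.\<close>

definition travel_cost :: "'v ctp_input \<Rightarrow> 'v set set \<Rightarrow> 'v strategy \<Rightarrow> ennreal" where
  "travel_cost I B \<sigma> =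
     (if \<exists>n. last (walk I B \<sigma> n) = destination I
      then ennreal (walk_cost (edge_cost I)
             (walk I B \<sigma> (LEAST n. last (walk I B \<sigma> n) = destination I)))
      else \<infinity>)"

text \<open>
  A randomized online algorithm draws a deterministic strategy at random, from a distribution that
  may depend on the advance information but not on the blocked edges, which are fixed beforehand.
\<close>

type_synonym 'v randomized_algorithm = "'v ctp_input \<Rightarrow> 'v strategy pmf"

definition expected_cost ::
  "'v randomized_algorithm \<Rightarrow> 'v ctp_input \<Rightarrow> 'v set set \<Rightarrow> ennreal" where
  "expected_cost A I B = (\<integral>\<^sup>+\<sigma>. travel_cost I B \<sigma> \<partial>measure_pmf (A I))"

definition competitive_on ::
  "'v ctp_input set \<Rightarrow> real \<Rightarrow> real \<Rightarrow> 'v randomized_algorithm \<Rightarrow> bool" where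
  "competitive_on \<I> \<alpha> \<beta> A \<longleftrightarrow>
     (\<forall>I\<in>\<I>. \<forall>B. valid_instance I B \<longrightarrow>
        (B = prediction I \<longrightarrow> expected_cost A I B \<le> ennreal (\<alpha> * OPT I B)) \<and>
        (B \<noteq> prediction I \<longrightarrow> expected_cost A I B \<le> ennreal (\<beta> * OPT I B)))"

end

theory Submission
  imports Defs
begin

text \<open>
  Let \<open>p\<close> be a cheapest path from source to destination and \<open>q\<close> a cheapest one among the others, of
  costs \<open>a\<close> and \<open>b\<close>. As \<open>k = 1\<close> and no edge is shared, the optimum is \<open>a\<close> if \<open>p\<close> is free and \<open>b\<close>
  otherwise. Trying \<open>p\<close> first and falling back on \<open>q\<close> costs \<open>a\<close> in the first case and at most
  \<open>2 a + b\<close> in the second; trying \<open>q\<close> first costs at most \<open>2 b + a\<close> and \<open>b\<close>, respectively. If \<open>p\<close>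
  is tried first with probability \<open>m\<close>, the expected costs are at most \<open>a + 2 (1 - m) b\<close> and
  \<open>b + 2 m a\<close>, and by AM-GM some \<open>m\<close> makes these at most \<open>(1 + 1/l) a\<close> and \<open>(1 + l) b\<close>, for any
  given \<open>l > 0\<close>. Take \<open>l = \<epsilon>\<close> if the predicted edge lies on \<open>p\<close>, and \<open>l = 1/\<epsilon>\<close> otherwise.
\<close>

section \<open>Walks and their costs\<close>

lemma walk_cost_simps [simp]:
  "walk_cost c [] = 0"
  "walk_cost c [x] = 0"
  "walk_cost c (x # y # zs) = c {x, y} + walk_cost c (y # zs)"
  by (simp_all add: walk_cost_def)

lemma walk_cost_append:
  "walk_cost c (xs @ x # ys) = walk_cost c (xs @ [x]) + walk_cost c (x # ys)"
  by (induction xs rule: induct_list012) auto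

lemma walk_cost_rev: "walk_cost c (rev xs) = walk_cost c xs"
proof (induction xs rule: induct_list012)
  case (3 x y zs)
  then show ?case
    using walk_cost_append[of c "rev zs" y "[x]"] by (simp add: insert_commute)
qed auto

lemma walk_cost_nonneg:
  assumes "successively (\<lambda>x y. {x, y} \<in> F) w" and "\<And>e. e \<in> F \<Longrightarrow> 0 \<le> c e"
  shows "0 \<le> walk_cost c w"
  using assms(1) by (induction w rule: induct_list012) (auto intro!: add_nonneg_nonneg assms(2))

lemma successively_conj_iff:
  "successively (\<lambda>x y. P x y \<and> Q x y) xs \<longleftrightarrow> successively P xs \<and> successively Q xs"
  by (auto simp: successively_conv_nth)

lemma is_path_Diff:
  "is_path (F - B) u v p \<longleftrightarrow> is_path F u v p \<and> successively (\<lambda>x y. {x, y} \<notin> B) p"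
  by (auto simp: is_path_def successively_conj_iff)

text \<open>Each edge of the list has its earlier endpoint in \<open>xs\<close>, and that already
  keeps it out of \<open>B\<close>. The last vertex \<open>v\<close> may touch \<open>B\<close>:
  this is where the traveller first sees a blocked edge.\<close>

lemma successively_not_mem_if_avoids:
  assumes "\<And>x. x \<in> set xs \<Longrightarrow> x \<notin> \<Union>B"
  shows "successively (\<lambda>x y. {x, y} \<notin> B) (xs @ [v])"
  unfolding successively_conv_nth
proof (intro allI impI)
  fix i
  assume "Suc i < length (xs @ [v])"
  then have "(xs @ [v]) ! i \<in> set xs" by (auto simp: nth_append)
  then show "{(xs @ [v]) ! i, (xs @ [v]) ! Suc i} \<notin> B" using assms by blast
qed

lemma successively_undirected_rev:
  "successively (\<lambda>x y. {x, y} \<in> F) (rev w) \<longleftrightarrow> successively (\<lambda>x y. {x, y} \<in> F) w"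
  by (simp add: insert_commute)

text \<open>By distinctness \<open>s\<close> occurs only at the first index and \<open>t\<close>
  only at the last, so an edge joining them takes up the whole path.\<close>

lemma is_path_using_end_edge:
  assumes "is_path F s t p" and "\<not> successively (\<lambda>x y. {x, y} \<noteq> {s, t}) p"
  shows "p = [s, t]"
proof -
  obtain i where i: "Suc i < length p" "{p ! i, p ! Suc i} = {s, t}"
    using assms(2) by (auto simp: successively_conv_nth)
  have d: "distinct p" and "p \<noteq> []" "p ! 0 = s" "p ! (length p - 1) = t"
    using assms(1) by (auto simp: is_path_def hd_conv_nth last_conv_nth)
  have ne: "p ! i \<noteq> p ! Suc i"
    using d i(1) by (simp add: nth_eq_iff_index_eq)
  have "p ! Suc i \<noteq> s"
    using d i(1) \<open>p ! 0 = s\<close> nth_eq_iff_index_eq[of p "Suc i" 0] by fastforce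
  then have "p ! i = s" "p ! Suc i = t"
    using i(2) ne by (auto simp: doubleton_eq_iff)
  then have "p ! i = p ! 0" "p ! Suc i = p ! (length p - 1)" "0 < length p"
    using \<open>p ! 0 = s\<close> \<open>p ! (length p - 1) = t\<close> \<open>p \<noteq> []\<close> by simp_all
  then have "i = 0" "Suc i = length p - 1"
    using d i(1) by (simp_all add: nth_eq_iff_index_eq)
  then have "length p = 2" by simp
  with \<open>i = 0\<close> \<open>p ! i = s\<close> \<open>p ! Suc i = t\<close> show ?thesis
    by (auto simp: length_Suc_conv numeral_2_eq_2)
qed

text \<open>Node-disjointness still allows a common edge between source and destination. A path
  through that edge consists of it alone, so two distinct paths cannot both use it.\<close>

lemma path_disjoint_shared_edge:
  assumes "path_disjoint I"
    and "is_path (edges I) (source I) (destination I) p"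
    and "is_path (edges I) (source I) (destination I) q"
    and "p \<noteq> q" and "\<not> successively (\<lambda>x y. {x, y} \<noteq> b) p"
  shows "successively (\<lambda>x y. {x, y} \<noteq> b) q"
proof (rule ccontr)
  assume nq: "\<not> ?thesis"
  have sub: "b \<subseteq> set r \<and> card b = 2"
    if "\<not> successively (\<lambda>x y. {x, y} \<noteq> b) r" "distinct r" for r
    using that by (auto simp: successively_conv_nth nth_eq_iff_index_eq card_insert_if)
  have "b \<subseteq> set p" "b \<subseteq> set q" and card: "card b = 2"
    using sub[of p] sub[of q] assms(2,3,5) nq by (auto simp: is_path_def)
  then have "b \<subseteq> {source I, destination I}"
    using assms(1-4) unfolding path_disjoint_def by blast
  moreover have "card {source I, destination I} \<le> card b"
    using card by (simp add: card_insert_if)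
  ultimately have "b = {source I, destination I}"
    by (intro card_seteq) auto
  then show False
    using is_path_using_end_edge[OF assms(2)] is_path_using_end_edge[OF assms(3)] assms(4,5) nq
    by simp
qed

lemma finite_paths:
  assumes "valid_input I"
  shows "finite {p. is_path (edges I) (source I) (destination I) p}"
proof (rule finite_subset)
  show "finite {p. set p \<subseteq> nodes I \<and> distinct p}"
    using assms by (intro finite_subset_distinct) (simp add: valid_input_def)
  \<comment> \<open>\<open>is_path\<close> does not mention \<open>nodes\<close>. Membership comes
    from the edges, except for a one-vertex path, where it comes from the first vertex.\<close>
  have in_nodes: "set p \<subseteq> nodes I"
    if "successively (\<lambda>x y. {x, y} \<in> edges I) p" "p \<noteq> []" "hd p \<in> nodes I" for p
    using that
  proof (induction p rule: induct_list012)
    case (3 x y zs)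
    have "{x, y} \<in> {{u, v} | u v. u \<in> nodes I \<and> v \<in> nodes I \<and> u \<noteq> v}"
      using 3(3) assms unfolding valid_input_def by auto
    then have "{x, y} \<subseteq> nodes I" by (auto simp: doubleton_eq_iff)
    with 3 show ?case by auto
  qed auto
  have "source I \<in> nodes I" using assms by (simp add: valid_input_def)
  then show "{p. is_path (edges I) (source I) (destination I) p}
      \<subseteq> {p. set p \<subseteq> nodes I \<and> distinct p}"
    by (intro Collect_mono) (simp add: is_path_def in_nodes)
qed

lemma OPT_eqI:
  assumes "valid_input I" and "is_path (edges I - B) (source I) (destination I) p"
    and "\<And>q. is_path (edges I - B) (source I) (destination I) q \<Longrightarrow>
           walk_cost (edge_cost I) p \<le> walk_cost (edge_cost I) q"
  shows "OPT I B = walk_cost (edge_cost I) p"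
  unfolding OPT_def
proof (rule Min_eqI)
  show "finite (walk_cost (edge_cost I) ` {p. is_path (edges I - B) (source I) (destination I) p})"
    using finite_paths[OF assms(1)]
    by (intro finite_imageI) (rule finite_subset[rotated], auto simp: is_path_Diff)
qed (use assms(2,3) in auto)

section \<open>Following a path with a fallback\<close>

text \<open>The plan may change as edges are observed; it need only agree with \<open>W\<close> at
  the next index, which is the length of the walk so far. As the destination occurs in
  \<open>W\<close> only at the end, the walk does not stop early.\<close>

lemma travel_cost_follow:
  assumes "W \<noteq> []" "hd W = source I" "last W = destination I" "destination I \<notin> set (butlast W)"
    and "successively (\<lambda>x y. {x, y} \<in> edges I - B) W"
    and "\<And>n. Suc n < length W \<Longrightarrow> plan (observed B (take (Suc n) W)) ! Suc n = W ! Suc n"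
  shows "travel_cost I B (\<lambda>w X. plan X ! length w) = ennreal (walk_cost (edge_cost I) W)"
proof -
  let ?\<sigma> = "\<lambda>w X. plan X ! length w"
  have last_take: "last (take (Suc n) W) = W ! n" if "n < length W" for n
    using that by (simp add: take_Suc_conv_app_nth)
  have before: "W ! n \<noteq> destination I" if "Suc n < length W" for n
    using that assms(4)
    by (metis length_butlast less_diff_conv nth_butlast nth_mem add.commute plus_1_eq_Suc)
  have walk: "walk I B ?\<sigma> n = take (Suc n) W" if "n < length W" for n
    using that
  proof (induction n)
    case 0
    then show ?case using assms(1,2) by (cases W) auto
  next
    case (Suc n)
    then show ?case
      using assms(6)[of n] before[of n] last_take[of n] successively_nth[OF assms(5), of n]
      by (auto simp: Let_def take_Suc_conv_app_nth[of "Suc n" W])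
  qed
  define N where "N = length W - 1"
  have N: "N < length W" "Suc N = length W"
    using assms(1) by (auto simp: N_def)
  have arrive: "last (walk I B ?\<sigma> N) = destination I"
    using assms(1,3) N walk[of N] by simp
  have "(LEAST n. last (walk I B ?\<sigma> n) = destination I) = N"
  proof (rule Least_equality)
    fix n
    assume n: "last (walk I B ?\<sigma> n) = destination I"
    show "N \<le> n"
    proof (rule ccontr)
      assume "\<not> N \<le> n"
      then have "Suc n < length W" using N by simp
      then show False using n walk[of n] last_take[of n] before[of n] by simp
    qed
  qed (rule arrive)
  then show ?thesis
    using arrive walk[of N] N unfolding travel_cost_def by auto
qed

text \<open>
  A strategy reads its next vertex off the complete walk planned for the blocked edges \<open>X\<close> observed
  so far. With at most one blocked edge, replanning never alters the part already walked.
\<close>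

definition fallback_plan :: "'v list \<Rightarrow> 'v list \<Rightarrow> 'v set set \<Rightarrow> 'v list" where
  "fallback_plan p q X =
     (if successively (\<lambda>x y. {x, y} \<notin> X) p then p
      else let u = takeWhile (\<lambda>x. x \<notin> \<Union>X) p in u @ p ! length u # rev u @ tl q)"

definition try_path :: "'v list \<Rightarrow> 'v list \<Rightarrow> 'v strategy" where
  "try_path p q = (\<lambda>w X. fallback_plan p q X ! length w)"

lemma travel_cost_try_free:
  assumes "is_path (edges I - B) (source I) (destination I) p"
  shows "travel_cost I B (try_path p q) = ennreal (walk_cost (edge_cost I) p)"
  unfolding try_path_def
proof (rule travel_cost_follow)
  have p: "p \<noteq> []" "distinct p" "last p = destination I"
    using assms by (auto simp: is_path_def)
  then have "distinct (butlast p @ [destination I])"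
    by (metis append_butlast_last_id)
  then show "destination I \<notin> set (butlast p)" by simp
  fix n
  have "successively (\<lambda>x y. {x, y} \<notin> B) p"
    using assms by (simp add: is_path_Diff)
  then have "successively (\<lambda>x y. {x, y} \<notin> observed B (take (Suc n) p)) p"
    by (auto elim!: successively_mono simp: observed_def)
  then show "fallback_plan p q (observed B (take (Suc n) p)) ! Suc n = p ! Suc n"
    by (simp add: fallback_plan_def)
qed (use assms in \<open>auto simp: is_path_def\<close>)

text \<open>The traveller sees \<open>b\<close> at its first endpoint on \<open>p\<close>, before
  having to cross it. The way there and back costs at most twice \<open>p\<close>, and
  \<open>q\<close> is then walked from the source.\<close>

lemma travel_cost_try_blocked:
  assumes p: "is_path (edges I) (source I) (destination I) p"
    and blocked: "\<not> successively (\<lambda>x y. {x, y} \<noteq> b) p"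
    and q: "is_path (edges I - {b}) (source I) (destination I) q"
    and nonneg: "\<And>e. e \<in> edges I \<Longrightarrow> 0 \<le> edge_cost I e"
  shows "travel_cost I {b} (try_path p q)
    \<le> ennreal (2 * walk_cost (edge_cost I) p + walk_cost (edge_cost I) q)"
proof -
  let ?c = "edge_cost I" and ?s = "source I" and ?t = "destination I"
  define u where "u = takeWhile (\<lambda>x. x \<notin> b) p"
  have u: "x \<notin> b" if "x \<in> set u" for x
    using that by (auto simp: u_def dest: set_takeWhileD)
  have "u \<noteq> p"
  proof
    assume "u = p"
    then have "successively (\<lambda>x y. {x, y} \<noteq> b) p"
      \<comment> \<open>The appended vertex is arbitrary: only the edges of \<open>p\<close> itself
        matter.\<close>
      using u successively_not_mem_if_avoids[of p "{b}" undefined]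
      by (auto simp: successively_append_iff)
    with blocked show False by simp
  qed
  then obtain v ys where pv: "p = u @ v # ys" and v: "v \<in> b"
    unfolding u_def
    by (metis append_Nil2 hd_dropWhile list.exhaust_sel takeWhile_dropWhile_id)
  have su: "successively (\<lambda>x y. {x, y} \<noteq> b) (u @ [v])"
    using successively_not_mem_if_avoids[of u "{b}" v] u by simp
  \<comment> \<open>The edge \<open>b\<close> lies on \<open>p\<close> but not on
    \<open>u @ [v]\<close>, so \<open>p\<close> continues after \<open>v\<close>. Hence the
    destination is not met on the way out.\<close>
  with blocked pv have "ys \<noteq> []" by auto
  have p': "distinct p" "hd p = ?s" "last p = ?t" "successively (\<lambda>x y. {x, y} \<in> edges I) p"
    using p by (auto simp: is_path_def)
  have t: "?t \<notin> set (u @ [v])"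
  proof -
    have "?t \<in> set ys" using p'(3) pv \<open>ys \<noteq> []\<close> last_in_set[of ys] by auto
    then show ?thesis using p'(1) pv by auto
  qed
  have q': "q \<noteq> []" "hd q = ?s" "last q = ?t" "distinct q"
    "successively (\<lambda>x y. {x, y} \<in> edges I - {b}) q"
    using q by (auto simp: is_path_def)
  have tq: "?t \<notin> set (butlast q)"
  proof -
    have "distinct (butlast q @ [?t])"
      using q' by (metis append_butlast_last_id)
    then show ?thesis by simp
  qed
  \<comment> \<open>Out to \<open>v\<close>, back to the source, then along \<open>q\<close>, whose
    first vertex is dropped because \<open>rev u\<close> ends there. If \<open>u\<close> is empty,
    \<open>v\<close> is the source itself.\<close>
  define W where "W = u @ v # rev u @ tl q"
  have out: "successively (\<lambda>x y. {x, y} \<in> edges I - {b}) (u @ [v])"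
    using su p'(4) pv \<open>ys \<noteq> []\<close> by (auto simp: successively_append_iff successively_conj_iff)
  have plan: "fallback_plan p q {b} = W"
    using blocked nth_append_length[of u v ys, folded pv]
    by (simp add: fallback_plan_def W_def u_def[symmetric])
  \<comment> \<open>The same walk, with the source at the junction counted to \<open>q\<close>
    instead of the loop; in this form cost and validity split into loop and
    \<open>q\<close>.\<close>
  have detour: "W = butlast (u @ v # rev u) @ q"
  proof (cases u)
    case Nil
    then show ?thesis using pv p'(2) q'(1,2) by (cases q) (auto simp: W_def)
  next
    case (Cons a u')
    then show ?thesis using pv p'(2) q'(1,2) by (cases q) (auto simp: W_def butlast_append)
  qed
  have loop: "u @ v # rev u = butlast (u @ v # rev u) @ [?s]"
  proof -
    have "last (u @ v # rev u) = ?s"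
      using pv p'(2) by (cases u) auto
    then show ?thesis by (metis append_butlast_last_id append_is_Nil_conv list.distinct(1))
  qed
  have succ_loop: "successively (\<lambda>x y. {x, y} \<in> edges I - {b}) (u @ v # rev u)"
  proof -
    have "successively (\<lambda>x y. {x, y} \<in> edges I - {b}) (rev (u @ [v]))"
      using out unfolding successively_undirected_rev .
    then show ?thesis
      using out by (auto simp: successively_append_iff)
  qed
  have succ_W: "successively (\<lambda>x y. {x, y} \<in> edges I - {b}) W"
    using succ_loop q' unfolding detour
    by (subst (asm) loop) (auto simp: successively_append_iff)
  have "travel_cost I {b} (\<lambda>w X. fallback_plan p q X ! length w) = ennreal (walk_cost ?c W)"
  proof (rule travel_cost_follow[OF _ _ _ _ succ_W])
    show "W \<noteq> []" by (simp add: W_def)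
    show "hd W = ?s" using pv p'(2) by (cases u) (auto simp: W_def)
    show "last W = ?t" using q' by (simp add: detour)
    have "?t \<notin> set (butlast (u @ v # rev u))"
      using t by (auto dest!: in_set_butlastD)
    then show "?t \<notin> set (butlast W)"
      using tq q'(1) by (auto simp: detour butlast_append)
    fix n
    assume n: "Suc n < length W"
    show "fallback_plan p q (observed {b} (take (Suc n) W)) ! Suc n = W ! Suc n"
    \<comment> \<open>While the visited vertices lie in \<open>u\<close>, nothing is observed and
      the plan is \<open>p\<close>, which agrees with \<open>W\<close> up to and including
      \<open>v\<close> at index \<open>length u\<close>. Once \<open>v\<close> is visited,
      \<open>b\<close> is known and the plan is \<open>W\<close>.\<close>
    proof (cases "Suc n \<le> length u")
      case True
      then have "set (take (Suc n) W) \<subseteq> set u"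
        by (auto simp: W_def dest: in_set_takeD)
      then have "observed {b} (take (Suc n) W) = {}"
        using u by (auto simp: observed_def)
      then show ?thesis
        using True by (auto simp: fallback_plan_def successively_conv_nth pv W_def nth_append)
    next
      case False
      then have "v \<in> set (take (Suc n) W)"
        by (auto simp: W_def take_Cons')
      then have "observed {b} (take (Suc n) W) = {b}"
        using v by (auto simp: observed_def)
      then show ?thesis by (simp add: plan)
    qed
  qed
  moreover have "walk_cost ?c W \<le> 2 * walk_cost ?c p + walk_cost ?c q"
  proof -
    have "walk_cost ?c W = walk_cost ?c (u @ v # rev u) + walk_cost ?c q"
      unfolding detour using walk_cost_append[of ?c "butlast (u @ v # rev u)" ?s "tl q"] loop q'
      by (cases q) auto
    also have "walk_cost ?c (u @ v # rev u) = 2 * walk_cost ?c (u @ [v])"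
      using walk_cost_append[of ?c u v "rev u"] walk_cost_rev[of ?c "u @ [v]"] by simp
    also have "walk_cost ?c (u @ [v]) \<le> walk_cost ?c p"
    proof -
      have "0 \<le> walk_cost ?c (v # ys)"
        using p'(4) pv nonneg by (intro walk_cost_nonneg) (auto simp: successively_append_iff)
      then show ?thesis using walk_cost_append[of ?c u v ys] pv by simp
    qed
    finally show ?thesis by simp
  qed
  ultimately show ?thesis
    unfolding try_path_def by (simp add: ennreal_leI)
qed

lemma valid_instance_budget_one:
  assumes "valid_instance I B" "budget I = 1"
  obtains "B = {}" | b where "B = {b}"
proof -
  have "finite (edges I)"
    using assms(1)
    by (intro finite_subset[of "edges I" "Pow (nodes I)"]) (auto simp: valid_instance_def valid_input_def)
  then have "finite B" "card B \<le> 1"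
    using assms by (auto simp: valid_instance_def intro: finite_subset)
  then have "B = {} \<or> (\<exists>b. B = {b})"
    by (metis card_0_eq card_1_singletonE le_eq_less_or_eq less_one)
  then show thesis using that by blast
qed

section \<open>Mixing two orders of trial\<close>

text \<open>A bound that holds whether or not \<open>p\<close> is blocked, for use when the status
  of the path tried first is unknown.\<close>

lemma travel_cost_try_le:
  assumes "valid_instance I B" "budget I = 1"
    and p: "is_path (edges I) (source I) (destination I) p"
    and q: "is_path (edges I - B) (source I) (destination I) q"
  shows "travel_cost I B (try_path p q)
    \<le> ennreal (2 * walk_cost (edge_cost I) p + walk_cost (edge_cost I) q)"
proof (cases "successively (\<lambda>x y. {x, y} \<notin> B) p")
  case True
  have nonneg: "0 \<le> walk_cost (edge_cost I) r" if "is_path (edges I) (source I) (destination I) r" for r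
    using that assms(1)
    by (intro walk_cost_nonneg) (auto simp: is_path_def valid_instance_def valid_input_def)
  show ?thesis
    using True p q nonneg[of p] nonneg[of q]
    by (subst travel_cost_try_free) (auto simp: is_path_Diff simp del: ennreal_plus intro: ennreal_leI)
next
  case False
  then obtain b where "B = {b}"
    using assms(1,2) by (auto elim!: valid_instance_budget_one simp: successively_conv_nth)
  then show ?thesis
    using False assms by (auto intro!: travel_cost_try_blocked simp: valid_instance_def valid_input_def)
qed

lemma balanced_probability:
  fixes a b l :: real
  assumes "0 \<le> a" "0 \<le> b" "0 < l"
  shows "\<exists>m. 0 \<le> m \<and> m \<le> 1 \<and> 2 * m * a \<le> l * b \<and> 2 * (1 - m) * b \<le> a / l"
proof (cases "2 * a \<le> l * b")
  case True
  then show ?thesis using assms by (intro exI[of _ 1]) auto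
next
  case False
  then have "0 < a" using assms by (smt (verit) mult_nonneg_nonneg)
  \<comment> \<open>This makes the first inequality an equality. The second, multiplied by
    \<open>a * l\<close>, becomes the nonnegativity of the square below.\<close>
  define m where "m = l * b / (2 * a)"
  have "0 \<le> (a - l * b)\<^sup>2" by simp
  then have "2 * (1 - m) * b \<le> a / l"
    using \<open>0 < a\<close> \<open>0 < l\<close> by (simp add: m_def field_simps power2_eq_square)
  then show ?thesis
    using False assms \<open>0 < a\<close> by (intro exI[of _ m]) (auto simp: m_def field_simps)
qed

lemma nn_integral_bernoulli_choice_le:
  assumes "0 \<le> m" "m \<le> 1" "0 \<le> x" "0 \<le> y" "f u \<le> ennreal x" "f v \<le> ennreal y"
  shows "(\<integral>\<^sup>+\<sigma>. f \<sigma> \<partial>measure_pmf (map_pmf (\<lambda>h. if h then u else v) (bernoulli_pmf m)))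
    \<le> ennreal (m * x + (1 - m) * y)"
proof -
  have "(\<integral>\<^sup>+\<sigma>. f \<sigma> \<partial>measure_pmf (map_pmf (\<lambda>h. if h then u else v) (bernoulli_pmf m)))
      = f u * ennreal m + f v * ennreal (1 - m)"
    using assms(1,2) by simp
  also have "\<dots> \<le> ennreal x * ennreal m + ennreal y * ennreal (1 - m)"
    using assms by (intro add_mono mult_right_mono) auto
  also have "\<dots> = ennreal (m * x + (1 - m) * y)"
    using assms by (simp add: ennreal_mult[symmetric] ennreal_plus[symmetric] mult.commute del: ennreal_plus)
  finally show ?thesis .
qed

text \<open>One distribution must serve all \<open>B\<close>. The factors depend on whether
  \<open>p\<close> is free, not on the prediction, which can thus enter later through the choice of
  \<open>l\<close> alone.\<close>

lemma mixture_exists: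
  fixes I :: "'v ctp_input"
  assumes I: "valid_input I" "budget I = 1" "path_disjoint I" and "0 < l"
    and p: "is_path (edges I) (source I) (destination I) p"
    and p_min: "\<And>r. is_path (edges I) (source I) (destination I) r \<Longrightarrow>
        walk_cost (edge_cost I) p \<le> walk_cost (edge_cost I) r"
  shows "\<exists>D :: 'v strategy pmf. \<forall>B. valid_instance I B \<longrightarrow>
    (\<integral>\<^sup>+\<sigma>. travel_cost I B \<sigma> \<partial>measure_pmf D)
      \<le> ennreal ((if successively (\<lambda>x y. {x, y} \<notin> B) p then 1 + 1 / l else 1 + l) * OPT I B)"
proof -
  let ?c = "walk_cost (edge_cost I)" and ?path = "is_path (edges I) (source I) (destination I)"
  have nonneg: "0 \<le> ?c r" if "?path r" for r
    using that I(1) by (intro walk_cost_nonneg) (auto simp: is_path_def valid_input_def)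
  \<comment> \<open>If \<open>p\<close> is the only path, \<open>q = p\<close> serves as a default.
    This is harmless: \<open>p\<close> cannot then be blocked, since some path stays free.\<close>
  have "\<exists>q. ?path q \<and> (\<forall>r. ?path r \<and> r \<noteq> p \<longrightarrow> q \<noteq> p \<and> ?c q \<le> ?c r)"
  proof (cases "\<exists>r. ?path r \<and> r \<noteq> p")
    case True
    have "finite {r. ?path r \<and> r \<noteq> p}"
      by (rule finite_subset[OF _ finite_paths[OF I(1)]]) blast
    moreover have "{r. ?path r \<and> r \<noteq> p} \<noteq> {}"
      using True by blast
    ultimately obtain q where "is_arg_min ?c (\<lambda>r. r \<in> {r. ?path r \<and> r \<noteq> p}) q"
      using ex_is_arg_min_if_finite by blast
    then show ?thesis
      unfolding is_arg_min_linorder mem_Collect_eq by blast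
  next
    case False
    with p show ?thesis by blast
  qed
  then obtain q where q: "?path q" and q_min: "\<And>r. ?path r \<Longrightarrow> r \<noteq> p \<Longrightarrow> q \<noteq> p \<and> ?c q \<le> ?c r"
    by blast
  obtain m where m: "0 \<le> m" "m \<le> 1" "2 * m * ?c p \<le> l * ?c q" "2 * (1 - m) * ?c q \<le> ?c p / l"
    using balanced_probability[OF nonneg[OF p] nonneg[OF q] \<open>0 < l\<close>] by blast
  define D where "D = map_pmf (\<lambda>h. if h then try_path p q else try_path q p) (bernoulli_pmf m)"
  have "(\<integral>\<^sup>+\<sigma>. travel_cost I B \<sigma> \<partial>measure_pmf D)
      \<le> ennreal ((if successively (\<lambda>x y. {x, y} \<notin> B) p then 1 + 1 / l else 1 + l) * OPT I B)"
    if B: "valid_instance I B" for B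
  proof (cases "successively (\<lambda>x y. {x, y} \<notin> B) p")
    case True
    then have p_free: "is_path (edges I - B) (source I) (destination I) p"
      using p by (simp add: is_path_Diff)
    have opt: "OPT I B = ?c p"
      using p_free p_min by (intro OPT_eqI I) (auto simp: is_path_Diff)
    \<comment> \<open>Here \<open>q\<close> may be blocked or free, so its trial is charged
      \<open>2 * ?c q + ?c p\<close> in either case.\<close>
    have "(\<integral>\<^sup>+\<sigma>. travel_cost I B \<sigma> \<partial>measure_pmf D)
        \<le> ennreal (m * ?c p + (1 - m) * (2 * ?c q + ?c p))"
      unfolding D_def
      using travel_cost_try_free[OF p_free, of q] travel_cost_try_le[OF B I(2) q p_free]
        nonneg[OF p] nonneg[OF q] m
      by (intro nn_integral_bernoulli_choice_le) auto
    also have "\<dots> \<le> ennreal ((1 + 1 / l) * OPT I B)"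
      using m(4) by (intro ennreal_leI) (simp add: opt algebra_simps)
    finally show ?thesis using True by simp
  next
    case False
    then obtain b where b: "B = {b}"
      using B I(2) by (auto elim!: valid_instance_budget_one simp: successively_conv_nth)
    obtain r where r: "is_path (edges I - B) (source I) (destination I) r"
      using B by (auto simp: valid_instance_def)
    have other: "r \<noteq> p" if "is_path (edges I - B) (source I) (destination I) r" for r
      using that False by (auto simp: is_path_Diff)
    \<comment> \<open>The surviving path \<open>r\<close> differs from \<open>p\<close>, so
      \<open>q\<close> is not the default. As \<open>b\<close> lies on \<open>p\<close>,
      path-disjointness keeps it off \<open>q\<close>.\<close>
    have "q \<noteq> p"
      using q_min[of r] r other by (auto simp: is_path_Diff)
    then have q_free: "is_path (edges I - B) (source I) (destination I) q"
      using path_disjoint_shared_edge[OF I(3) p q, of b] False q b by (auto simp: is_path_Diff)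
    have opt: "OPT I B = ?c q"
      using q_free q_min other by (intro OPT_eqI I) (auto simp: is_path_Diff)
    have "(\<integral>\<^sup>+\<sigma>. travel_cost I B \<sigma> \<partial>measure_pmf D)
        \<le> ennreal (m * (2 * ?c p + ?c q) + (1 - m) * ?c q)"
      unfolding D_def
      using travel_cost_try_free[OF q_free, of p] travel_cost_try_le[OF B I(2) p q_free]
        nonneg[OF p] nonneg[OF q] m
      by (intro nn_integral_bernoulli_choice_le) auto
    also have "\<dots> \<le> ennreal ((1 + l) * OPT I B)"
      using m(3) by (intro ennreal_leI) (simp add: opt algebra_simps)
    finally show ?thesis using False by simp
  qed
  then show ?thesis by blast
qed

lemma OPT_nonneg:
  assumes "valid_instance I B"
  shows "0 \<le> OPT I B"
proof -
  have I: "valid_input I" using assms by (simp add: valid_instance_def)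
  let ?P = "{p. is_path (edges I - B) (source I) (destination I) p}"
  have "finite ?P"
    by (rule finite_subset[OF _ finite_paths[OF I]]) (auto simp: is_path_Diff)
  moreover have "?P \<noteq> {}" using assms by (auto simp: valid_instance_def)
  moreover have "0 \<le> walk_cost (edge_cost I) p" if "p \<in> ?P" for p
    using that I unfolding mem_Collect_eq is_path_Diff
    by (intro walk_cost_nonneg[of "edges I"]) (auto simp: is_path_def valid_input_def)
  ultimately show ?thesis by (auto simp: OPT_def)
qed

theorem theorem5:
  fixes \<epsilon> :: real
  assumes "0 < \<epsilon>" and "\<epsilon> \<le> 1"
  shows "\<exists>A :: 'v randomized_algorithm.
           competitive_on {I. budget I = 1 \<and> path_disjoint I} (1 + \<epsilon>) (1 + 1 / \<epsilon>) A"
proof -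
  \<comment> \<open>The algorithm sees only the input, so it suffices to find one good distribution
    per input and apply choice. An invalid input has no valid instance, and any distribution is good
    for it.\<close>
  define good where "good I D \<longleftrightarrow> (\<forall>B. valid_instance I B \<longrightarrow>
      (\<integral>\<^sup>+\<sigma>. travel_cost I B \<sigma> \<partial>measure_pmf D)
        \<le> ennreal ((if B = prediction I then 1 + \<epsilon> else 1 + 1 / \<epsilon>) * OPT I B))"
    for I :: "'v ctp_input" and D
  have "\<exists>D. good I D"
    if I: "budget I = 1" "path_disjoint I" for I :: "'v ctp_input"
  proof (cases "valid_input I")
    case True
    let ?path = "is_path (edges I) (source I) (destination I)"
    have "{r. ?path r} \<noteq> {}"
      using True by (auto simp: valid_input_def)
    then obtain p where p: "?path p"
      and p_min: "\<And>r. ?path r \<Longrightarrow> walk_cost (edge_cost I) p \<le> walk_cost (edge_cost I) r"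
      using ex_is_arg_min_if_finite[OF finite_paths[OF True], of "walk_cost (edge_cost I)"]
      by (auto simp: is_arg_min_linorder)
    define l where "l = (if successively (\<lambda>x y. {x, y} \<notin> prediction I) p then 1 / \<epsilon> else \<epsilon>)"
    have "0 < l" using assms by (simp add: l_def)
    obtain D where D: "\<And>B. valid_instance I B \<Longrightarrow>
        (\<integral>\<^sup>+\<sigma>. travel_cost I B \<sigma> \<partial>measure_pmf D)
          \<le> ennreal ((if successively (\<lambda>x y. {x, y} \<notin> B) p then 1 + 1 / l else 1 + l) * OPT I B)"
      using mixture_exists[OF True I \<open>0 < l\<close> p p_min] by blast
    \<comment> \<open>If the prediction is correct, it tells whether \<open>p\<close> is free, and
      \<open>l\<close> was chosen to make the factor of that case 1 + \<epsilon>. If it is wrong,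
      either factor may occur, and this inequality bounds both by 1 + 1/\<epsilon>.\<close>
    have "\<epsilon> \<le> 1 / \<epsilon>"
      using assms by (simp add: field_simps mult_le_one)
    then have "ennreal ((if successively (\<lambda>x y. {x, y} \<notin> B) p then 1 + 1 / l else 1 + l) * OPT I B)
        \<le> ennreal ((if B = prediction I then 1 + \<epsilon> else 1 + 1 / \<epsilon>) * OPT I B)"
      if "valid_instance I B" for B
      using OPT_nonneg[OF that] by (intro ennreal_leI mult_right_mono) (auto simp: l_def)
    with D show ?thesis
      unfolding good_def by (meson order_trans)
  qed (auto simp: valid_instance_def good_def)
  then obtain A where A: "\<And>I. budget I = 1 \<Longrightarrow> path_disjoint I \<Longrightarrow> good I (A I)"
    by metis
  show ?thesis
    unfolding competitive_on_def expected_cost_def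
  proof (intro exI[of _ A] ballI allI impI)
    fix I :: "'v ctp_input" and B
    assume "I \<in> {I. budget I = 1 \<and> path_disjoint I}" and B: "valid_instance I B"
    then have "good I (A I)" using A by simp
    with B show "(B = prediction I \<longrightarrow>
          (\<integral>\<^sup>+\<sigma>. travel_cost I B \<sigma> \<partial>measure_pmf (A I)) \<le> ennreal ((1 + \<epsilon>) * OPT I B)) \<and>
        (B \<noteq> prediction I \<longrightarrow>
          (\<integral>\<^sup>+\<sigma>. travel_cost I B \<sigma> \<partial>measure_pmf (A I)) \<le> ennreal ((1 + 1 / \<epsilon>) * OPT I B))"
      unfolding good_def by (smt (verit))
  qed
qed

end
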